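(* For every even integer coarse-graining factor $n>1$, there exists a two-dimensional layout for the toric-code hierarchy (for all $K$ and $L$ with $n^K\mid L$) with the following properties. There are constants $\delta>0$ and $0<c<\infty$, depending only on $n$, such that: - any two distinct sites are separated by distance at least $\delta$; - slice-$k$ nearest-neighbor sites are separated by distance $O(n^k)$; - same-slice nearest-neighbor wires for slice $k$ have length $O(n^k)$; - promotion wires from slice $k$ to slice $k+1$ have length $O(n^{k+1})$; - at most $c$ wires pass through any point on the torus. Here all distances and lengths are measured with respect to the Euclidean metric.
   Context: Toric-code hierarchy: for integers $K\ge1$ and $L$ divisible by $n^K$, the slices are $\Lambda_k=(\mathbb Z/(L/n^k)\mathbb Z)^2$, $k=0,\dots,K-1$; its sites are all elements of all slices (sites of different slices are distinct sites). For $k\le K-2$, writing the representative in $\{0,\dots,L/n^k-1\}^2$ of $\mathbf r\in\Lambda_k$ as $n\mathbf r'+\mathbf a$ with $\mathbf a\in\{0,\dots,n-1\}^2$, the parent of $\mathbf r$ is $\pi_k(\mathbf r)=\mathbf r'\in\Lambda_{k+1}$. There is one wire between each pair of nearest-neighbor sites of the same slice (same-slice wires), and one wire between each site $\mathbf r\in\Lambda_k$, $k\le K-2$, and its parent $\pi_k(\mathbf r)$ (promotion wires). A layout assigns to each site a point of the flat $L\times L$ torus $(\mathbb R/L\mathbb Z)^2$ and to each wire a curve on this torus joining the points of its two end sites. The implied constants in $O(\cdot)$ are independent of $k$, $K$ and $L$. *)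

theory Defs
  imports "HOL-Analysis.Analysis" "HOL-Number_Theory.Cong"
begin

section \<open>The toric-code hierarchy\<close>

text \<open>The site \<open>(k, (x, y))\<close> is the element of slice \<open>k\<close> whose representative in
  \<open>{0..<L div n ^ k} \<times> {0..<L div n ^ k}\<close> is \<open>(x, y)\<close>.\<close>

type_synonym site = "nat \<times> (nat \<times> nat)"

definition slice :: "nat \<Rightarrow> nat \<Rightarrow> nat \<Rightarrow> (nat \<times> nat) set" where
  "slice n L k = {0..<L div n ^ k} \<times> {0..<L div n ^ k}"

definition sites :: "nat \<Rightarrow> nat \<Rightarrow> nat \<Rightarrow> site set" where
  "sites n K L = (SIGMA k:{0..<K}. slice n L k)"

definition parent :: "nat \<Rightarrow> nat \<times> nat \<Rightarrow> nat \<times> nat" where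
  "parent n r = (fst r div n, snd r div n)"

definition cyclic_adjacent :: "nat \<Rightarrow> nat \<Rightarrow> nat \<Rightarrow> bool" where
  "cyclic_adjacent m a b \<longleftrightarrow> [b = a + 1] (mod m) \<or> [a = b + 1] (mod m)"

definition nearest_neighbors :: "nat \<Rightarrow> nat \<Rightarrow> nat \<Rightarrow> nat \<times> nat \<Rightarrow> nat \<times> nat \<Rightarrow> bool" where
  "nearest_neighbors n L k r s \<longleftrightarrow>
     r \<in> slice n L k \<and> s \<in> slice n L k \<and>
     (cyclic_adjacent (L div n ^ k) (fst r) (fst s) \<and> snd r = snd s \<or>
      fst r = fst s \<and> cyclic_adjacent (L div n ^ k) (snd r) (snd s))"

text \<open>A wire is the unordered pair of its end sites. For \<open>L > 0\<close>, \<open>n > 1\<close> and \<open>n ^ K\<close>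
  dividing \<open>L\<close>, every slice \<open>k < K\<close> has side at least 2, so there are no loops; on a slice
  of side 2 the two steps \<open>+1\<close> and \<open>-1\<close> lead to the same neighbor, which is joined by one wire.\<close>

type_synonym wire = "site set"

definition slice_wires :: "nat \<Rightarrow> nat \<Rightarrow> nat \<Rightarrow> wire set" where
  "slice_wires n L k = {{(k, r), (k, s)} | r s. nearest_neighbors n L k r s}"

definition promotion_wires :: "nat \<Rightarrow> nat \<Rightarrow> nat \<Rightarrow> wire set" where
  "promotion_wires n L k = {{(k, r), (Suc k, parent n r)} | r. r \<in> slice n L k}"

definition wires :: "nat \<Rightarrow> nat \<Rightarrow> nat \<Rightarrow> wire set" where
  "wires n K L = (\<Union>k\<in>{k. k < K}. slice_wires n L k) \<union>
                 (\<Union>k\<in>{k. Suc k < K}. promotion_wires n L k)"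

lemma finite_wires: "finite (wires n K L)"
proof -
  have fin: "finite (slice n L k)" for k
    by (simp add: slice_def)
  have "slice_wires n L k \<subseteq> (\<lambda>(r, s). {(k, r), (k, s)}) ` (slice n L k \<times> slice n L k)" for k
    by (auto simp: slice_wires_def nearest_neighbors_def)
  then have "finite (slice_wires n L k)" for k
    using fin by (meson finite_SigmaI finite_imageI finite_subset)
  moreover have "promotion_wires n L k = (\<lambda>r. {(k, r), (Suc k, parent n r)}) ` slice n L k" for k
    by (auto simp: promotion_wires_def)
  then have "finite (promotion_wires n L k)" for k
    using fin by simp
  moreover have "finite {k. Suc k < K}"
    by (rule finite_subset[of _ "{..<K}"]) auto
  ultimately show ?thesis
    by (simp add: wires_def)
qed

section \<open>The flat torus\<close>

text \<open>Points of the torus of side \<open>L\<close> are the cosets of the lattice \<open>L \<int>\<^sup>2\<close> in the plane. The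
  flat metric is the quotient of the Euclidean metric on \<^typ>\<open>real \<times> real\<close>, which is the
  infimum of the distances between representatives, that is \<^const>\<open>setdist\<close>.\<close>

type_synonym torus_point = "(real \<times> real) set"

definition lattice_rel :: "nat \<Rightarrow> ((real \<times> real) \<times> (real \<times> real)) set" where
  "lattice_rel L = {(p, q). \<exists>i j :: int. q = p + (real L * of_int i, real L * of_int j)}"

definition torus :: "nat \<Rightarrow> torus_point set" where
  "torus L = UNIV // lattice_rel L"

abbreviation torus_dist :: "torus_point \<Rightarrow> torus_point \<Rightarrow> real" where
  "torus_dist \<equiv> setdist"

lemma equiv_lattice_rel: "equiv UNIV (lattice_rel L)"
proof (rule equivI)
  show "lattice_rel L \<subseteq> UNIV \<times> UNIV" by simp
  show "refl (lattice_rel L)"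
    unfolding refl_on_def lattice_rel_def
    by (auto simp: zero_prod_def[symmetric] intro!: exI[of _ "0::int"])
  show "sym (lattice_rel L)"
  proof (rule symI)
    fix p q assume "(p, q) \<in> lattice_rel L"
    then obtain i j :: int where "q = p + (real L * of_int i, real L * of_int j)"
      by (auto simp: lattice_rel_def)
    then have "p = q + (real L * of_int (- i), real L * of_int (- j))"
      by (cases p) auto
    then show "(q, p) \<in> lattice_rel L"
      unfolding lattice_rel_def by blast
  qed
  show "trans (lattice_rel L)"
  proof (rule transI)
    fix p q r assume "(p, q) \<in> lattice_rel L" "(q, r) \<in> lattice_rel L"
    then obtain i j i' j' :: int where
      "q = p + (real L * of_int i, real L * of_int j)"
      "r = q + (real L * of_int i', real L * of_int j')"
      unfolding lattice_rel_def by blast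
    then have "r = p + (real L * of_int (i + i'), real L * of_int (j + j'))"
      by (cases p) (auto simp: algebra_simps)
    then show "(p, r) \<in> lattice_rel L"
      unfolding lattice_rel_def by blast
  qed
qed

lemma setdist_torus_rep:
  assumes X: "X \<in> torus L" and Y: "Y \<in> torus L" and p: "p \<in> X"
  shows "torus_dist X Y = setdist {p} Y"
proof (rule antisym)
  show "setdist X Y \<le> setdist {p} Y"
    using p by (rule setdist_le_sing)
  show "setdist {p} Y \<le> setdist X Y"
  proof (rule le_setdistI)
    show "X \<noteq> {}" "Y \<noteq> {}"
      using X Y equiv_lattice_rel in_quotient_imp_non_empty unfolding torus_def by blast+
    fix x y assume x: "x \<in> X" and y: "y \<in> Y"
    have "(x, p) \<in> lattice_rel L"
      using X x p quotient_eq_iff[OF equiv_lattice_rel] unfolding torus_def by blast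
    then obtain i j :: int where ij: "p = x + (real L * of_int i, real L * of_int j)"
      by (auto simp: lattice_rel_def)
    define y' where "y' = y + (real L * of_int i, real L * of_int j)"
    have "(y, y') \<in> lattice_rel L"
      unfolding lattice_rel_def y'_def by blast
    then have "y' \<in> Y"
      using Y y in_quotient_imp_closed[OF equiv_lattice_rel] unfolding torus_def by blast
    then have "setdist {p} Y \<le> dist p y'"
      by (simp add: setdist_le_dist)
    also have "\<dots> = dist x y"
      by (simp add: ij y'_def)
    finally show "setdist {p} Y \<le> dist x y" .
  qed
qed

lemma Metric_space_torus:
  assumes L: "L > 0"
  shows "Metric_space (torus L) torus_dist"
proof
  show "0 \<le> torus_dist X Y" "torus_dist X Y = torus_dist Y X" for X Y
    by (auto simp: setdist_sym)
next
  fix X Y assume X: "X \<in> torus L" and Y: "Y \<in> torus L"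
  show "torus_dist X Y = 0 \<longleftrightarrow> X = Y"
  proof
    assume 0: "torus_dist X Y = 0"
    obtain p where p: "p \<in> X"
      using X equiv_lattice_rel in_quotient_imp_non_empty unfolding torus_def by blast
    have Yne: "Y \<noteq> {}"
      using Y equiv_lattice_rel in_quotient_imp_non_empty unfolding torus_def by blast
    have sep: "real L \<le> dist y z" if "y \<in> Y" "z \<in> Y" "y \<noteq> z" for y z
    proof -
      have "(y, z) \<in> lattice_rel L"
        using Y that quotient_eq_iff[OF equiv_lattice_rel] unfolding torus_def by blast
      then obtain i j :: int where ij: "z = y + (real L * of_int i, real L * of_int j)"
        by (auto simp: lattice_rel_def)
      have d: "dist y z = norm (real L * of_int i, real L * of_int j :: real)"
        by (simp add: ij dist_norm norm_Pair)
      have "i \<noteq> 0 \<or> j \<noteq> 0"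
        using ij that(3) by (auto simp: zero_prod_def[symmetric])
      then have "real L \<le> \<bar>real L * of_int i\<bar> \<or> real L \<le> \<bar>real L * of_int j\<bar>"
        using L by (auto simp: abs_mult mult_le_cancel_left1)
      then show ?thesis
        using d norm_fst_le[of "real L * of_int i" "real L * of_int j :: real"]
          norm_snd_le[of "real L * of_int j" "real L * of_int i :: real"] by auto
    qed
    have "closed Y"
      using L sep by (intro discrete_imp_closed[of "real L"]) (auto simp: dist_commute not_less[symmetric])
    moreover have "setdist {p} Y = 0"
      using 0 setdist_torus_rep[OF X Y p] by simp
    ultimately have "p \<in> Y"
      using Yne by (simp add: setdist_eq_0_sing_1)
    then show "X = Y"
      using X Y p quotient_disj[OF equiv_lattice_rel] unfolding torus_def by blast
  qed (simp add: setdist_refl)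
next
  fix X Y Z assume X: "X \<in> torus L" and Y: "Y \<in> torus L" and Z: "Z \<in> torus L"
  obtain q where q: "q \<in> Y"
    using Y equiv_lattice_rel in_quotient_imp_non_empty unfolding torus_def by blast
  show "torus_dist X Z \<le> torus_dist X Y + torus_dist Y Z"
    using setdist_triangle[of X Z q] setdist_torus_rep[OF Y X q] setdist_torus_rep[OF Y Z q]
    by (simp add: setdist_sym)
qed

definition torus_topology :: "nat \<Rightarrow> torus_point topology" where
  "torus_topology L = Metric_space.mtopology (torus L) torus_dist"

text \<open>A curve is a path parametrised by \<open>{0..1}\<close>; its length is the supremum of the lengths of
  inscribed polygons.\<close>

definition curve_length :: "(real \<Rightarrow> torus_point) \<Rightarrow> ennreal" where
  "curve_length \<gamma> = (SUP ts \<in> {ts. sorted ts \<and> set ts \<subseteq> {0..1}}.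
     \<Sum>i<length ts - 1. ennreal (torus_dist (\<gamma> (ts ! i)) (\<gamma> (ts ! Suc i))))"

section \<open>Layouts\<close>

text \<open>The last condition says that the curve of a wire joins the positions of the two end
  sites of the wire, in either direction.\<close>

definition is_layout ::
  "nat \<Rightarrow> nat \<Rightarrow> nat \<Rightarrow> (site \<Rightarrow> torus_point) \<Rightarrow> (wire \<Rightarrow> real \<Rightarrow> torus_point) \<Rightarrow> bool" where
  "is_layout n K L pos curve \<longleftrightarrow>
     (\<forall>u\<in>sites n K L. pos u \<in> torus L) \<and>
     (\<forall>w\<in>wires n K L. pathin (torus_topology L) (curve w) \<and>
        {curve w 0, curve w 1} = pos ` w)"

end

theory Submission
  imports Defs
begin

text \<open>Put the site \<open>(k, (x, y))\<close> at the center \<open>(n ^ k * (x + 1/2), n ^ k * (y + 1/2))\<close> of the square of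
  side \<open>n ^ k\<close> that it represents, and draw every wire as a horizontal leg followed by a vertical
  leg. Since \<open>n\<close> is even, a number \<open>n ^ k * (a + 1/2)\<close> with \<open>a\<close> an integer determines \<open>k\<close> and \<open>a\<close>.
  So sites of different slices never share a coordinate. A horizontal leg lies at the height of the
  site where the wire starts and a vertical leg at the abscissa of the site where it ends, so a
  point of the torus lies only on wires of at most three slices, and within a slice only boundedly
  many wires come close to the point.\<close>

section \<open>Curves on the torus\<close>

definition torus_proj :: "nat \<Rightarrow> real \<times> real \<Rightarrow> torus_point" where
  "torus_proj L p = lattice_rel L `` {p}"

lemma torus_proj_in_torus: "torus_proj L p \<in> torus L"
  unfolding torus_proj_def torus_def by (simp add: quotientI)

lemma mem_torus_proj_iff:
  "q \<in> torus_proj L p \<longleftrightarrow> (\<exists>i j :: int. q = p + (real L * of_int i, real L * of_int j))"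
  by (simp add: torus_proj_def lattice_rel_def)

lemma torus_proj_self: "p \<in> torus_proj L p"
  unfolding torus_proj_def using equiv_lattice_rel by (rule equiv_class_self) simp

lemma torus_proj_add_lattice:
  "torus_proj L (p + (real L * of_int i, real L * of_int j)) = torus_proj L p"
  unfolding torus_proj_def
  by (rule equiv_class_eq[OF equiv_lattice_rel, symmetric]) (auto simp: lattice_rel_def)

lemma torus_dist_proj_le: "torus_dist (torus_proj L p) (torus_proj L q) \<le> dist p q"
  by (intro setdist_le_dist torus_proj_self)

text \<open>Each chord is at most \<open>M\<close> times its parameter step, and along a sorted list
  these bounds telescope.\<close>

lemma curve_length_le_lipschitz:
  assumes M: "M \<ge> 0"
    and lip: "\<And>s t. s \<in> {0..1} \<Longrightarrow> t \<in> {0..1} \<Longrightarrow> torus_dist (\<gamma> s) (\<gamma> t) \<le> M * \<bar>s - t\<bar>"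
  shows "curve_length \<gamma> \<le> ennreal M"
  unfolding curve_length_def
proof (rule SUP_least)
  fix ts :: "real list" assume "ts \<in> {ts. sorted ts \<and> set ts \<subseteq> {0..1}}"
  then have srt: "sorted ts" and sub: "set ts \<subseteq> {0..1}"
    by auto
  have mem: "ts ! i \<in> {0..1}" if "i < length ts" for i
    using sub that nth_mem by blast
  have step: "torus_dist (\<gamma> (ts ! i)) (\<gamma> (ts ! Suc i)) \<le> M * ts ! Suc i - M * ts ! i"
    if "i < length ts - 1" for i
  proof -
    have i: "i < length ts" "Suc i < length ts"
      using that by auto
    then have "\<bar>ts ! i - ts ! Suc i\<bar> = ts ! Suc i - ts ! i"
      using sorted_nth_mono[OF srt, of i "Suc i"] by simp
    then show ?thesis
      using lip[OF mem[OF i(1)] mem[OF i(2)]] by (simp add: right_diff_distrib)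
  qed
  have "(\<Sum>i<length ts - 1. ennreal (torus_dist (\<gamma> (ts ! i)) (\<gamma> (ts ! Suc i)))) =
      ennreal (\<Sum>i<length ts - 1. torus_dist (\<gamma> (ts ! i)) (\<gamma> (ts ! Suc i)))"
    by (simp add: sum_ennreal)
  also have "\<dots> \<le> ennreal M"
  proof (rule ennreal_leI)
    have "(\<Sum>i<length ts - 1. torus_dist (\<gamma> (ts ! i)) (\<gamma> (ts ! Suc i))) \<le>
        (\<Sum>i<length ts - 1. M * ts ! Suc i - M * ts ! i)"
      using step by (intro sum_mono) simp
    also have "\<dots> = M * ts ! (length ts - 1) - M * ts ! 0"
      by (rule sum_lessThan_telescope)
    also have "\<dots> \<le> M"
    \<comment> \<open>For the empty list both indices are 0, so the difference vanishes whatever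
      \<open>ts ! 0\<close> is.\<close>
    proof (cases "ts = []")
      case False
      then have "M * ts ! (length ts - 1) \<le> M * 1" "0 \<le> M * ts ! 0"
        using M mem[of "length ts - 1"] mem[of 0] by (auto intro!: mult_left_le)
      then show ?thesis by linarith
    qed (use M in simp)
    finally show "(\<Sum>i<length ts - 1. torus_dist (\<gamma> (ts ! i)) (\<gamma> (ts ! Suc i))) \<le> M" .
  qed
  finally show "(\<Sum>i<length ts - 1. ennreal (torus_dist (\<gamma> (ts ! i)) (\<gamma> (ts ! Suc i)))) \<le> ennreal M" .
qed

lemma pathin_torus_lipschitz:
  assumes L: "L > 0" and in_torus: "\<And>t. t \<in> {0..1} \<Longrightarrow> \<gamma> t \<in> torus L"
    and lip: "\<And>s t. s \<in> {0..1} \<Longrightarrow> t \<in> {0..1} \<Longrightarrow> torus_dist (\<gamma> s) (\<gamma> t) \<le> M * \<bar>s - t\<bar>"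
  shows "pathin (torus_topology L) \<gamma>"
proof -
  interpret T: Metric_space "torus L" torus_dist
    using L by (rule Metric_space_torus)
  show ?thesis
    unfolding pathin_def torus_topology_def T.continuous_map_to_metric
  proof (intro ballI allI impI)
    fix s \<epsilon> :: real assume "s \<in> topspace (top_of_set {0..1})" and \<epsilon>: "\<epsilon> > 0"
    then have s: "s \<in> {0..1}" by simp
    \<comment> \<open>The divisor \<open>\<bar>M\<bar> + 1\<close> is positive and dominates
      \<open>M\<close>.\<close>
    let ?U = "{0..1} \<inter> ball s (\<epsilon> / (\<bar>M\<bar> + 1))"
    have "openin (top_of_set {0..1}) ?U" "s \<in> ?U"
      using s \<epsilon> by (auto simp: openin_open_Int)
    moreover have "\<gamma> t \<in> T.mball (\<gamma> s) \<epsilon>" if "t \<in> ?U" for t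
    proof -
      have t: "t \<in> {0..1}" and "\<bar>s - t\<bar> < \<epsilon> / (\<bar>M\<bar> + 1)"
        using that by (auto simp: dist_real_def)
      then have "(\<bar>M\<bar> + 1) * \<bar>s - t\<bar> < \<epsilon>"
        by (simp add: pos_less_divide_eq mult.commute)
      moreover have "M * \<bar>s - t\<bar> \<le> (\<bar>M\<bar> + 1) * \<bar>s - t\<bar>"
        by (intro mult_right_mono) auto
      ultimately have "torus_dist (\<gamma> s) (\<gamma> t) < \<epsilon>"
        using lip[OF s t] by linarith
      then show ?thesis
        using in_torus s t by simp
    qed
    ultimately show "\<exists>U. openin (top_of_set {0..1}) U \<and> s \<in> U \<and> (\<forall>t\<in>U. \<gamma> t \<in> T.mball (\<gamma> s) \<epsilon>)"
      by blast
  qed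
qed

section \<open>Paths with one corner\<close>

definition corner_path :: "real \<times> real \<Rightarrow> real \<times> real \<Rightarrow> real \<Rightarrow> real \<times> real" where
  "corner_path p q t =
     (fst p + min (2 * t) 1 * (fst q - fst p), snd p + max (2 * t - 1) 0 * (snd q - snd p))"

lemma corner_path_0: "corner_path p q 0 = p"
  and corner_path_1: "corner_path p q 1 = q"
  by (simp_all add: corner_path_def)

text \<open>Each leg is run through in half of the unit interval, so both clamps are 2-Lipschitz;
  the norm of a pair is at most the sum of the norms of its components.\<close>

lemma corner_path_lipschitz:
  "dist (corner_path p q s) (corner_path p q t) \<le>
     2 * (\<bar>fst q - fst p\<bar> + \<bar>snd q - snd p\<bar>) * \<bar>s - t\<bar>"
proof -
  have "dist (corner_path p q s) (corner_path p q t) =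
      norm ((min (2 * s) 1 - min (2 * t) 1) * (fst q - fst p),
        (max (2 * s - 1) 0 - max (2 * t - 1) 0) * (snd q - snd p))"
    by (simp add: dist_norm corner_path_def left_diff_distrib)
  also have "\<dots> \<le>
      \<bar>min (2 * s) 1 - min (2 * t) 1\<bar> * \<bar>fst q - fst p\<bar> +
      \<bar>max (2 * s - 1) 0 - max (2 * t - 1) 0\<bar> * \<bar>snd q - snd p\<bar>"
    by (rule order_trans[OF norm_Pair_le]) (simp add: abs_mult)
  also have "\<dots> \<le> (2 * \<bar>s - t\<bar>) * \<bar>fst q - fst p\<bar> + (2 * \<bar>s - t\<bar>) * \<bar>snd q - snd p\<bar>"
    by (intro add_mono mult_right_mono) (auto simp: min_def max_def abs_if)
  finally show ?thesis
    by (simp add: algebra_simps)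
qed

lemma corner_path_near_start:
  assumes "t \<in> {0..1}"
  shows "\<bar>fst (corner_path p q t) - fst p\<bar> \<le> \<bar>fst q - fst p\<bar>"
    and "\<bar>snd (corner_path p q t) - snd p\<bar> \<le> \<bar>snd q - snd p\<bar>"
  using assms by (auto simp: corner_path_def abs_mult min_def max_def intro!: mult_left_le_one_le)

lemma corner_path_legs: "snd (corner_path p q t) = snd p \<or> fst (corner_path p q t) = fst q"
  by (auto simp: corner_path_def min_def max_def)

section \<open>Slices and coordinates\<close>

text \<open>The coordinates available to slice \<open>k\<close>. The index runs over all integers,
  so that all lifts of a site to the plane are covered at once.\<close>

definition half_grid :: "nat \<Rightarrow> nat \<Rightarrow> real set" where
  "half_grid n k = range (\<lambda>a::int. real n ^ k * (of_int a + 1/2))"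

text \<open>Parity: for \<open>k \<le> l\<close>, cancelling \<open>n ^ k\<close> and doubling gives
  \<open>2 * a + 1 = n ^ (l - k) * (2 * b + 1)\<close>. The left side is odd, while the right side
  is even unless \<open>l = k\<close>.\<close>

lemma half_grid_unique:
  fixes a b :: int
  assumes n: "even n" "n > 1"
    and eq: "real n ^ k * (of_int a + 1/2) = real n ^ l * (of_int b + 1/2)"
  shows "k = l \<and> a = b"
proof -
  have *: "k = l \<and> a = b"
    if le: "k \<le> l" and eq: "real n ^ k * (of_int a + 1/2) = real n ^ l * (of_int b + 1/2)"
    for k l and a b :: int
  proof -
    have "real n ^ l = real n ^ k * real n ^ (l - k)"
      using le by (simp flip: power_add)
    then have "real n ^ k * (of_int a + 1/2) = real n ^ k * (real n ^ (l - k) * (of_int b + 1/2))"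
      using eq by simp
    then have "of_int a + 1/2 = real n ^ (l - k) * (of_int b + 1/2)"
      using n by simp
    then have "of_int (2 * a + 1) = (of_int (int n ^ (l - k) * (2 * b + 1)) :: real)"
      by (simp add: algebra_simps)
    then have int_eq: "2 * a + 1 = int n ^ (l - k) * (2 * b + 1)"
      by (simp only: of_int_eq_iff)
    have "even (int n ^ (l - k))" if "l \<noteq> k"
      using n that le by simp
    then have "l = k"
      using int_eq by (metis even_mult_iff even_plus_one_iff dvd_triv_left)
    then show ?thesis
      using int_eq by simp
  qed
  show ?thesis
    using *[of k l a b] *[of l k b a] eq by (metis linear)
qed

text \<open>If \<open>x\<close> lies in no half grid, any \<open>k0\<close> serves. This form lets a
  level be fixed for a coordinate before it is known whether any slice uses that coordinate.\<close>

lemma half_grid_levels: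
  assumes "even n" "n > 1"
  shows "\<exists>k0. \<forall>k. x \<in> half_grid n k \<longrightarrow> k = k0"
proof (cases "\<exists>k. x \<in> half_grid n k")
  case True
  then obtain k0 where "x \<in> half_grid n k0" ..
  then have "k = k0" if "x \<in> half_grid n k" for k
    using that half_grid_unique[OF assms] unfolding half_grid_def by blast
  then show ?thesis by blast
qed blast

text \<open>With \<open>L = n ^ k * m\<close>, a shift by \<open>L * i\<close> moves the index by
  \<open>m * i\<close>. Hence membership can be tested on any representative of a torus
  point.\<close>

lemma half_grid_shift:
  assumes "n ^ k dvd L"
  shows "x + real L * of_int i \<in> half_grid n k \<longleftrightarrow> x \<in> half_grid n k"
proof -
  obtain m where m: "real L = real n ^ k * real m"
    using assms by (metis dvdE of_nat_mult of_nat_power)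
  have "x + real L * of_int i \<in> half_grid n k" if "x \<in> half_grid n k" for x i
  proof -
    obtain a :: int where a: "x = real n ^ k * (of_int a + 1/2)"
      using \<open>x \<in> half_grid n k\<close> unfolding half_grid_def by blast
    have "x + real L * of_int i = real n ^ k * (of_int (a + int m * i) + 1/2)"
      unfolding a m by (simp add: algebra_simps)
    then show ?thesis
      unfolding half_grid_def by blast
  qed
  from this[of x i] this[of "x + real L * of_int i" "- i"] show ?thesis
    by auto
qed

section \<open>Site positions and their separation\<close>

definition site_point :: "nat \<Rightarrow> site \<Rightarrow> real \<times> real" where
  "site_point n u = (real n ^ fst u * (real (fst (snd u)) + 1/2),
                     real n ^ fst u * (real (snd (snd u)) + 1/2))"

lemma site_point_in_half_grid:
  "fst (site_point n u) \<in> half_grid n (fst u)" "snd (site_point n u) \<in> half_grid n (fst u)"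
  unfolding half_grid_def site_point_def
  by (rule image_eqI[of _ _ "int (fst (snd u))"], simp, simp,
      rule image_eqI[of _ _ "int (snd (snd u))"], simp, simp)

lemma slice_side:
  assumes "n ^ K dvd L" "k \<le> K"
  shows "real n ^ k * real (L div n ^ k) = real L"
proof -
  have "n ^ k dvd L"
    using assms by (meson dvd_trans le_imp_power_dvd)
  then have "n ^ k * (L div n ^ k) = L"
    by simp
  then show ?thesis
    by (metis of_nat_mult of_nat_power)
qed

lemma half_integer_separated:
  fixes a b :: real
  assumes "2 * a \<in> \<int>" "2 * b \<in> \<int>" "a \<noteq> b"
  shows "1/2 \<le> \<bar>a - b\<bar>"
proof -
  obtain i j :: int where ij: "2 * a = of_int i" "2 * b = of_int j"
    using assms(1,2) by (auto elim!: Ints_cases)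
  then have "i \<noteq> j"
    using assms(3) by auto
  then have "1 \<le> \<bar>i - j\<bar>"
    by simp
  then have "1 \<le> \<bar>of_int i - of_int j :: real\<bar>"
    by (metis of_int_1_le_iff of_int_abs of_int_diff)
  then show ?thesis
    unfolding ij[symmetric] by linarith
qed

text \<open>Twice a half-grid coordinate is an integer at every level, so two lifts that differ in a
  coordinate are at least \<open>1/2\<close> apart. Lifts that agree in both coordinates share level
  and indices by \<open>half_grid_unique\<close>, and so come from the same site.\<close>

lemma site_points_separated:
  assumes n: "even n" "n > 1" and L: "n ^ K dvd L"
    and u: "u \<in> sites n K L" and v: "v \<in> sites n K L" and neq: "u \<noteq> v"
  shows "1/2 \<le> torus_dist (torus_proj L (site_point n u)) (torus_proj L (site_point n v))"
proof (rule le_setdistI)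
  show "torus_proj L (site_point n u) \<noteq> {}" "torus_proj L (site_point n v) \<noteq> {}"
    using torus_proj_self by blast+
  fix p q assume "p \<in> torus_proj L (site_point n u)" and "q \<in> torus_proj L (site_point n v)"
  then obtain i j i' j' :: int where
    p: "p = site_point n u + (real L * of_int i, real L * of_int j)" and
    q: "q = site_point n v + (real L * of_int i', real L * of_int j')"
    by (auto simp: mem_torus_proj_iff)
  obtain k x y l x' y' where uv: "u = (k, (x, y))" "v = (l, (x', y'))"
    by (metis prod.exhaust)
  let ?m = "L div n ^ k" and ?m' = "L div n ^ l"
  have bounds: "x < ?m" "y < ?m" "x' < ?m'" "y' < ?m'" "k \<le> K" "l \<le> K"
    using u v uv by (auto simp: sites_def slice_def)
  have side: "real n ^ k * real ?m = real L" "real n ^ l * real ?m' = real L"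
    using slice_side[OF L] bounds by blast+
  \<comment> \<open>A shift by a multiple of \<open>L\<close> becomes a shift of the index by a
    multiple of the side of the slice, so every lift keeps the half-grid form.\<close>
  have coords:
    "fst p = real n ^ k * (of_int (int x + int ?m * i) + 1/2)"
    "snd p = real n ^ k * (of_int (int y + int ?m * j) + 1/2)"
    "fst q = real n ^ l * (of_int (int x' + int ?m' * i') + 1/2)"
    "snd q = real n ^ l * (of_int (int y' + int ?m' * j') + 1/2)"
    using side by (simp_all add: p q uv site_point_def algebra_simps)
  have neq': "fst p \<noteq> fst q \<or> snd p \<noteq> snd q"
  proof (rule ccontr)
    assume "\<not> ?thesis"
    then have eq: "fst p = fst q" "snd p = snd q"
      by auto
    have "k = l" "int x + int ?m * i = int x' + int ?m' * i'"
      using half_grid_unique[OF n eq(1)[unfolded coords]] by auto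
    moreover have "int y + int ?m * j = int y' + int ?m' * j'"
      using half_grid_unique[OF n eq(2)[unfolded coords]] by auto
    \<comment> \<open>The bounds on the representatives turn congruence modulo the side into
      equality.\<close>
    moreover have "z = z'" if "int z + int m * a = int z' + int m * a'" "z < m" "z' < m" for z z' m a a'
    proof -
      have "int z mod int m = int z' mod int m"
        using that(1) by (metis mod_mult_self2)
      then show ?thesis
        using that(2,3) by simp
    qed
    ultimately have "u = v"
      using uv bounds by blast
    then show False
      using neq by simp
  qed
  have ints: "2 * (real n ^ r * (of_int a + 1/2)) \<in> \<int>" for r and a :: int
  proof -
    have "2 * (real n ^ r * (of_int a + 1/2)) = of_int (int n ^ r * (2 * a + 1))"
      by (simp add: algebra_simps)
    then show ?thesis
      by (metis Ints_of_int)
  qed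
  have "1/2 \<le> \<bar>fst p - fst q\<bar> \<or> 1/2 \<le> \<bar>snd p - snd q\<bar>"
    using neq' half_integer_separated[OF ints ints] unfolding coords by blast
  moreover have "\<bar>fst p - fst q\<bar> \<le> dist p q" "\<bar>snd p - snd q\<bar> \<le> dist p q"
    using dist_fst_le[of p q] dist_snd_le[of p q] by (simp_all add: dist_real_def)
  ultimately show "1/2 \<le> dist p q"
    by linarith
qed

section \<open>Oriented wires\<close>

text \<open>Left and down are absent because wires are unordered: such a step is a
  \<open>Right\<close> or \<open>Up\<close> step from its other end.\<close>

datatype direction = Right | Up | Promote

type_synonym arrow = "nat \<times> (nat \<times> nat) \<times> direction"

fun arrow_target :: "nat \<Rightarrow> nat \<Rightarrow> arrow \<Rightarrow> site" where
  "arrow_target n L (k, (x, y), Right) = (k, ((x + 1) mod (L div n ^ k), y))"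
| "arrow_target n L (k, (x, y), Up) = (k, (x, (y + 1) mod (L div n ^ k)))"
| "arrow_target n L (k, r, Promote) = (Suc k, parent n r)"

definition arrow_wire :: "nat \<Rightarrow> nat \<Rightarrow> arrow \<Rightarrow> wire" where
  "arrow_wire n L c = {(fst c, fst (snd c)), arrow_target n L c}"

text \<open>An index set that covers all wires, possibly with repetitions: on a slice of side 2, two
  \<open>Right\<close> arrows give one wire. The \<open>Promote\<close> arrows of the top slice give
  no wire of the hierarchy.\<close>

definition arrows :: "nat \<Rightarrow> nat \<Rightarrow> nat \<Rightarrow> arrow set" where
  "arrows n K L = {(k, r, d). k < K \<and> r \<in> slice n L k}"

text \<open>The end point in the plane is not reduced modulo \<open>L\<close>, so that a wire crossing the boundary
  of the fundamental domain is short.\<close>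

fun arrow_end :: "nat \<Rightarrow> arrow \<Rightarrow> real \<times> real" where
  "arrow_end n (k, (x, y), Right) = site_point n (k, (x + 1, y))"
| "arrow_end n (k, (x, y), Up) = site_point n (k, (x, y + 1))"
| "arrow_end n (k, r, Promote) = site_point n (Suc k, parent n r)"

definition arrow_path :: "nat \<Rightarrow> arrow \<Rightarrow> real \<Rightarrow> real \<times> real" where
  "arrow_path n c = corner_path (site_point n (fst c, fst (snd c))) (arrow_end n c)"

text \<open>Reducing an index modulo the side \<open>m\<close> moves the point by a multiple of
  \<open>n ^ k * m = L\<close>. With \<open>x + 1\<close> or \<open>y + 1\<close> as index, this
  identifies the unreduced end of a path with its target site.\<close>

lemma torus_proj_site_mod:
  assumes L: "n ^ K dvd L" and k: "k \<le> K"
  shows "torus_proj L (site_point n (k, (x mod (L div n ^ k), y mod (L div n ^ k)))) =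
    torus_proj L (site_point n (k, (x, y)))"
proof -
  let ?m = "L div n ^ k"
  have side: "real n ^ k * real ?m = real L"
    using L k by (rule slice_side)
  have split: "real z = real (z mod ?m) + real ?m * real (z div ?m)" for z
    by (metis mod_mult_div_eq of_nat_add of_nat_mult)
  have coord: "real n ^ k * (real z + 1/2) = real n ^ k * (real (z mod ?m) + 1/2) +
      real L * of_int (int (z div ?m))" for z
    by (subst split) (simp add: algebra_simps flip: side)
  have "site_point n (k, (x, y)) = site_point n (k, (x mod ?m, y mod ?m)) +
      (real L * of_int (int (x div ?m)), real L * of_int (int (y div ?m)))"
    unfolding site_point_def fst_conv snd_conv add_Pair using coord by blast
  then show ?thesis
    by (simp only: torus_proj_add_lattice)
qed

lemma torus_proj_arrow_end:
  assumes L: "n ^ K dvd L" and c: "c \<in> arrows n K L"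
  shows "torus_proj L (arrow_end n c) = torus_proj L (site_point n (arrow_target n L c))"
proof -
  obtain k x y d where c_eq: "c = (k, (x, y), d)"
    by (metis prod.exhaust)
  have k: "k \<le> K" and "x < L div n ^ k" "y < L div n ^ k"
    using c unfolding c_eq arrows_def slice_def by auto
  then show ?thesis
    using torus_proj_site_mod[OF L k, of "x + 1" y] torus_proj_site_mod[OF L k, of x "y + 1"]
    unfolding c_eq by (cases d) (simp_all only: arrow_end.simps arrow_target.simps mod_less)
qed

lemma cyclic_successor:
  fixes a b m :: nat
  assumes "[b = a + 1] (mod m)" "b < m"
  shows "b = (a + 1) mod m"
  using assms by (simp add: cong_def)

lemma slice_wire_arrow:
  assumes "k < K" and nn: "nearest_neighbors n L k r s"
  shows "{(k, r), (k, s)} \<in> arrow_wire n L ` arrows n K L"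
proof -
  let ?m = "L div n ^ k"
  obtain x y x' y' where rs: "r = (x, y)" "s = (x', y')"
    by (metis prod.exhaust)
  have bounds: "x < ?m" "y < ?m" "x' < ?m" "y' < ?m"
    and adj: "cyclic_adjacent ?m x x' \<and> y = y' \<or> x = x' \<and> cyclic_adjacent ?m y y'"
    using nn unfolding nearest_neighbors_def rs slice_def by auto
  have "(k, r, d) \<in> arrows n K L" "(k, s, d) \<in> arrows n K L" for d
    using assms unfolding arrows_def nearest_neighbors_def by auto
  moreover have "\<exists>d. {(k, r), (k, s)} = arrow_wire n L (k, r, d) \<or>
      {(k, r), (k, s)} = arrow_wire n L (k, s, d)"
  proof -
    \<comment> \<open>The sign of the step decides at which of the two sites the arrow
      starts.\<close>
    consider "x' = (x + 1) mod ?m" "y = y'" | "x = (x' + 1) mod ?m" "y = y'"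
      | "y' = (y + 1) mod ?m" "x = x'" | "y = (y' + 1) mod ?m" "x = x'"
      using adj bounds cyclic_successor unfolding cyclic_adjacent_def by metis
    then show ?thesis
    proof cases
      case 1 then show ?thesis by (intro exI[of _ Right] disjI1) (simp add: rs arrow_wire_def)
    next
      case 2 then show ?thesis by (intro exI[of _ Right] disjI2) (simp add: rs arrow_wire_def insert_commute)
    next
      case 3 then show ?thesis by (intro exI[of _ Up] disjI1) (simp add: rs arrow_wire_def)
    next
      case 4 then show ?thesis by (intro exI[of _ Up] disjI2) (simp add: rs arrow_wire_def insert_commute)
    qed
  qed
  ultimately show ?thesis
    by blast
qed

lemma wires_subset_arrow_wires: "wires n K L \<subseteq> arrow_wire n L ` arrows n K L"
proof
  fix w assume "w \<in> wires n K L"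
  then consider (slice) k where "k < K" "w \<in> slice_wires n L k"
    | (promotion) k where "Suc k < K" "w \<in> promotion_wires n L k"
    unfolding wires_def by blast
  then show "w \<in> arrow_wire n L ` arrows n K L"
  proof cases
    case slice
    then show ?thesis
      using slice_wire_arrow unfolding slice_wires_def by blast
  next
    case promotion
    then obtain r where r: "r \<in> slice n L k" "w = {(k, r), (Suc k, parent n r)}"
      unfolding promotion_wires_def by blast
    then have "(k, r, Promote) \<in> arrows n K L" "w = arrow_wire n L (k, r, Promote)"
      using promotion by (auto simp: arrows_def arrow_wire_def)
    then show ?thesis
      by blast
  qed
qed

text \<open>The slices met by a wire reveal the slice of its arrow and whether the arrow is a
  promotion. This is what can be recovered about an arrow that is chosen only through its
  wire.\<close>

lemma arrow_wire_slices:
  "fst ` arrow_wire n L (k, r, d) = (if d = Promote then {k, Suc k} else {k})"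
  by (cases r; cases d) (auto simp: arrow_wire_def)

lemma slice_wire_arrow_cases:
  assumes "arrow_wire n L (k, r, d) \<in> slice_wires n L l"
  shows "k = l \<and> d \<noteq> Promote"
proof -
  obtain s t where "arrow_wire n L (k, r, d) = {(l, s), (l, t)}"
    using assms unfolding slice_wires_def by blast
  then have "fst ` arrow_wire n L (k, r, d) = {l}"
    by simp
  then show ?thesis
    unfolding arrow_wire_slices by (auto split: if_splits)
qed

lemma promotion_wire_arrow_cases:
  assumes "arrow_wire n L (k, r, d) \<in> promotion_wires n L l"
  shows "k = l"
proof -
  obtain s t where "arrow_wire n L (k, r, d) = {(l, s), (Suc l, t)}"
    using assms unfolding promotion_wires_def by blast
  then have "fst ` arrow_wire n L (k, r, d) = {l, Suc l}"
    by simp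
  then show ?thesis
    unfolding arrow_wire_slices by (auto split: if_splits simp: doubleton_eq_iff)
qed

section \<open>Displacement along an arrow\<close>

lemma parent_coordinate_near:
  fixes x k :: nat
  assumes "n > 0"
  shows "\<bar>real n ^ Suc k * (real (x div n) + 1/2) - real n ^ k * (real x + 1/2)\<bar> \<le> real n ^ Suc k"
proof -
  have "real x = real n * real (x div n) + real (x mod n)"
    by (metis mult_div_mod_eq of_nat_add of_nat_mult)
  \<comment> \<open>The offset of the site from the center of its parent square; the remainder
    \<open>x mod n\<close> is between 0 and \<open>n - 1\<close>.\<close>
  then have "real n ^ Suc k * (real (x div n) + 1/2) - real n ^ k * (real x + 1/2) =
      real n ^ k * (real n / 2 - 1/2 - real (x mod n))"
    by (simp add: algebra_simps)
  moreover have "\<bar>real n / 2 - 1/2 - real (x mod n)\<bar> \<le> real n"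
    using assms mod_less_divisor[OF assms, of x] by linarith
  ultimately show ?thesis
    by (simp add: abs_mult mult_left_mono mult.commute[of "real n"])
qed

lemma arrow_end_slice_near:
  assumes "d \<noteq> Promote"
  shows "\<bar>fst (arrow_end n (k, r, d)) - fst (site_point n (k, r))\<bar> +
    \<bar>snd (arrow_end n (k, r, d)) - snd (site_point n (k, r))\<bar> = real n ^ k"
  using assms by (cases r; cases d) (auto simp: site_point_def algebra_simps)

text \<open>A common bound for slice steps and promotions, so that the count can treat the three
  directions alike.\<close>

lemma arrow_end_near:
  assumes "n > 0"
  shows "\<bar>fst (arrow_end n (k, r, d)) - fst (site_point n (k, r))\<bar> \<le> real n ^ Suc k"
    and "\<bar>snd (arrow_end n (k, r, d)) - snd (site_point n (k, r))\<bar> \<le> real n ^ Suc k"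
proof -
  have le: "real n ^ k \<le> real n ^ Suc k"
    using assms by (intro power_increasing) auto
  have "\<bar>fst (arrow_end n (k, r, d)) - fst (site_point n (k, r))\<bar> \<le> real n ^ Suc k \<and>
      \<bar>snd (arrow_end n (k, r, d)) - snd (site_point n (k, r))\<bar> \<le> real n ^ Suc k"
  proof (cases "d = Promote")
    case True
    then show ?thesis
      using parent_coordinate_near[OF assms] by (simp add: site_point_def parent_def)
  next
    case False
    then show ?thesis
      using arrow_end_slice_near[OF False, of n k r] le by linarith
  qed
  then show "\<bar>fst (arrow_end n (k, r, d)) - fst (site_point n (k, r))\<bar> \<le> real n ^ Suc k"
    and "\<bar>snd (arrow_end n (k, r, d)) - snd (site_point n (k, r))\<bar> \<le> real n ^ Suc k"
    by auto
qed

text \<open>\<open>Right\<close> and \<open>Up\<close> end in slice \<open>k\<close>,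
  \<open>Promote\<close> in slice \<open>Suc k\<close>; the latter adds a third level to the
  count.\<close>

lemma fst_arrow_end_in_half_grid:
  "fst (arrow_end n (k, r, d)) \<in> half_grid n k \<union> half_grid n (Suc k)"
  using site_point_in_half_grid[of n "(k, _)"] site_point_in_half_grid[of n "(Suc k, _)"]
  by (cases r; cases d) auto

section \<open>Counting the wires through a point\<close>

text \<open>A number \<open>z < m\<close> is the residue of its lift \<open>z - m * i\<close>, which
  lies within \<open>n\<close> of \<open>\<zeta>\<close>, and an interval of length
  \<open>2 * n\<close> contains at most \<open>2 * n + 1\<close> integers. Two coordinates give the
  square.\<close>

lemma card_slice_near:
  fixes m n :: nat and \<xi> \<eta> :: real
  defines "near \<equiv> (\<lambda>m z \<zeta>. \<exists>i::int. \<bar>\<zeta> + real m * of_int i - real z\<bar> \<le> real n)"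
  shows "card {(x, y). x < m \<and> y < m \<and> near m x \<xi> \<and> near m y \<eta>} \<le> (2 * n + 1) ^ 2"
    and "finite {(x, y). x < m \<and> y < m \<and> near m x \<xi> \<and> near m y \<eta>}"
proof -
  define W where "W \<zeta> = (\<lambda>a. nat (a mod int m)) ` {\<lceil>\<zeta> - real n\<rceil>..\<lfloor>\<zeta> + real n\<rfloor>}" for \<zeta> :: real
  have finW: "finite (W \<zeta>)" and cardW: "card (W \<zeta>) \<le> 2 * n + 1" for \<zeta>
  proof -
    show "finite (W \<zeta>)"
      by (simp add: W_def)
    have "card (W \<zeta>) \<le> card {\<lceil>\<zeta> - real n\<rceil>..\<lfloor>\<zeta> + real n\<rfloor>}"
      unfolding W_def by (intro card_image_le) simp
    also have "\<dots> \<le> 2 * n + 1"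
      unfolding card_atLeastAtMost_int by linarith
    finally show "card (W \<zeta>) \<le> 2 * n + 1" .
  qed
  have nearW: "z \<in> W \<zeta>" if z: "z < m" "near m z \<zeta>" for z \<zeta>
  proof -
    obtain i :: int where i: "\<bar>\<zeta> + real m * of_int i - real z\<bar> \<le> real n"
      using z(2) unfolding near_def by blast
    define a where "a = int z - int m * i"
    have "of_int a = real z - real m * of_int i"
      by (simp add: a_def)
    then have "a \<in> {\<lceil>\<zeta> - real n\<rceil>..\<lfloor>\<zeta> + real n\<rfloor>}"
      using i unfolding atLeastAtMost_iff ceiling_le_iff le_floor_iff by linarith
    moreover have "a mod int m = int z"
      using z(1) by (simp add: a_def flip: mod_diff_eq)
    ultimately show ?thesis
      unfolding W_def by (intro image_eqI[of _ _ a]) auto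
  qed
  then have sub: "{(x, y). x < m \<and> y < m \<and> near m x \<xi> \<and> near m y \<eta>} \<subseteq> W \<xi> \<times> W \<eta>"
    by auto
  then show "finite {(x, y). x < m \<and> y < m \<and> near m x \<xi> \<and> near m y \<eta>}"
    using finW by (meson finite_SigmaI finite_subset)
  have "card {(x, y). x < m \<and> y < m \<and> near m x \<xi> \<and> near m y \<eta>} \<le> card (W \<xi> \<times> W \<eta>)"
    using sub finW by (intro card_mono) auto
  also have "\<dots> \<le> (2 * n + 1) ^ 2"
    unfolding card_cartesian_product power2_eq_square using cardW by (intro mult_mono) auto
  finally show "card {(x, y). x < m \<and> y < m \<and> near m x \<xi> \<and> near m y \<eta>} \<le> (2 * n + 1) ^ 2" .
qed

lemma arrows_through_point:
  assumes n: "even n" "n > 1" and L: "n ^ K dvd L" and X: "X \<in> torus L"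
  defines "S \<equiv> {c \<in> arrows n K L. X \<in> (torus_proj L \<circ> arrow_path n c) ` {0..1}}"
  shows "finite S \<and> card S \<le> 9 * (2 * n + 1) ^ 2"
proof -
  obtain p where p: "X = torus_proj L p"
    using X unfolding torus_def torus_proj_def quotient_def by blast
  obtain k1 k2 where k1: "\<And>k. fst p \<in> half_grid n k \<Longrightarrow> k = k1"
    and k2: "\<And>k. snd p \<in> half_grid n k \<Longrightarrow> k = k2"
    using half_grid_levels[OF n] by metis
  define near where "near m z \<zeta> \<longleftrightarrow> (\<exists>i::int. \<bar>\<zeta> + real m * of_int i - real z\<bar> \<le> real n)"
    for m z :: nat and \<zeta> :: real
  \<comment> \<open>Dividing by \<open>n ^ k\<close> and subtracting \<open>1/2\<close> puts the
    slice-\<open>k\<close> sites at integers and turns the displacement bound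
    \<open>n ^ Suc k\<close> into \<open>n\<close>, so the count is independent of
    \<open>k\<close>.\<close>
  define R where "R k = (let m = L div n ^ k in {(x, y). x < m \<and> y < m \<and>
    near m x (fst p / real n ^ k - 1/2) \<and> near m y (snd p / real n ^ k - 1/2)})" for k
  have R: "finite (R k)" "card (R k) \<le> (2 * n + 1) ^ 2" for k
    unfolding R_def near_def Let_def by (rule card_slice_near)+
  \<comment> \<open>A horizontal leg forces \<open>k = k2\<close>. A vertical leg forces
    \<open>k = k1\<close> if it ends in slice \<open>k\<close>, and \<open>k = k1 - 1\<close> if it
    ends in slice \<open>Suc k\<close>.\<close>
  define A where "A = (SIGMA k:{k1, k1 - 1, k2}. R k \<times> {Right, Up, Promote})"
  have "S \<subseteq> A"
  proof
    fix c assume c: "c \<in> S"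
    obtain k x y d where c_eq: "c = (k, (x, y), d)"
      by (metis prod.exhaust)
    have k: "k < K" and xy: "x < L div n ^ k" "y < L div n ^ k"
      using c unfolding S_def c_eq arrows_def slice_def by auto
    have side: "real n ^ k * real (L div n ^ k) = real L"
      using slice_side[OF L] k by simp
    obtain t where t: "t \<in> {0..1}" and Xt: "X = torus_proj L (arrow_path n c t)"
      using c unfolding S_def by auto
    let ?q = "arrow_path n c t"
    have "?q \<in> torus_proj L p"
      using torus_proj_self Xt p by metis
    then obtain i j :: int where q: "?q = p + (real L * of_int i, real L * of_int j)"
      unfolding mem_torus_proj_iff by blast
    have dvd: "n ^ l dvd L" if "l \<le> K" for l
      using L that by (meson dvd_trans le_imp_power_dvd)
    have "snd ?q \<in> half_grid n k \<or> fst ?q \<in> half_grid n k \<union> half_grid n (Suc k)"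
      using corner_path_legs[of "site_point n (k, (x, y))" "arrow_end n c" t]
        site_point_in_half_grid(2)[of n "(k, (x, y))"] fst_arrow_end_in_half_grid[of n k "(x, y)" d]
      unfolding arrow_path_def c_eq by auto
    \<comment> \<open>Since \<open>k < K\<close>, also \<open>n ^ Suc k\<close> divides
      \<open>L\<close>, so both half grids are invariant under the lattice shift from
      \<open>p\<close> to \<open>?q\<close>.\<close>
    then have "snd p \<in> half_grid n k \<or> fst p \<in> half_grid n k \<union> half_grid n (Suc k)"
      using half_grid_shift[OF dvd[of k]] half_grid_shift[OF dvd[of "Suc k"]] k q by simp
    then have level: "k \<in> {k1, k1 - 1, k2}"
      using k1 k2 by fastforce
    have "\<bar>fst ?q - fst (site_point n (k, (x, y)))\<bar> \<le> real n ^ Suc k"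
      "\<bar>snd ?q - snd (site_point n (k, (x, y)))\<bar> \<le> real n ^ Suc k"
      using corner_path_near_start[OF t, of "site_point n (k, (x, y))" "arrow_end n c"]
        arrow_end_near[of n k "(x, y)" d] n(2)
      unfolding arrow_path_def c_eq by auto
    moreover have "near (L div n ^ k) z (\<zeta> / real n ^ k - 1/2)"
      if "\<bar>\<zeta> + real L * of_int i - real n ^ k * (real z + 1/2)\<bar> \<le> real n ^ Suc k" for \<zeta> z i
    proof -
      have pos: "real n ^ k > 0"
        using n(2) by simp
      have "\<zeta> + real L * of_int i - real n ^ k * (real z + 1/2) =
          real n ^ k * (\<zeta> / real n ^ k - 1/2 + real (L div n ^ k) * of_int i - real z)"
        unfolding side[symmetric] using pos by (simp add: field_simps)
      then have "real n ^ k * \<bar>\<zeta> / real n ^ k - 1/2 + real (L div n ^ k) * of_int i - real z\<bar>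
          \<le> real n ^ k * real n"
        using that pos by (simp add: abs_mult mult.commute)
      then show ?thesis
        unfolding near_def using pos by (auto simp: mult_le_cancel_left_pos)
    qed
    ultimately have "(x, y) \<in> R k"
      unfolding R_def Let_def using xy q by (simp add: site_point_def)
    moreover have "d \<in> {Right, Up, Promote}"
      by (cases d) auto
    ultimately show "c \<in> A"
      unfolding A_def c_eq using level by simp
  qed
  moreover have finA: "finite A"
    unfolding A_def using R(1) by (intro finite_SigmaI) auto
  moreover have "card A \<le> 9 * (2 * n + 1) ^ 2"
  proof -
    have "card A = (\<Sum>k\<in>{k1, k1 - 1, k2}. card (R k \<times> {Right, Up, Promote}))"
      unfolding A_def using R(1) by (intro card_SigmaI) auto
    also have "\<dots> \<le> of_nat (card {k1, k1 - 1, k2}) * (3 * (2 * n + 1) ^ 2)"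
    proof (rule sum_bounded_above)
      show "card (R k \<times> {Right, Up, Promote}) \<le> 3 * (2 * n + 1) ^ 2" for k
        using R(2)[of k] by (simp only: card_cartesian_product) simp
    qed
    \<comment> \<open>The three levels may coincide, so their number is only bounded by 3; with
      three directions this gives the factor 9.\<close>
    also have "\<dots> \<le> 3 * (3 * (2 * n + 1) ^ 2)"
      using card_length[of "[k1, k1 - 1, k2]"] by (intro mult_right_mono) auto
    finally show ?thesis by simp
  qed
  ultimately show ?thesis
    by (meson card_mono finite_subset order_trans)
qed


section \<open>The layout and its constants\<close>

theorem lemma7p2:
  fixes n :: nat
  assumes "even n" and "n > 1"
  shows "\<exists>(pos :: nat \<Rightarrow> nat \<Rightarrow> site \<Rightarrow> torus_point)
          (curve :: nat \<Rightarrow> nat \<Rightarrow> wire \<Rightarrow> real \<Rightarrow> torus_point)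
          (\<delta> :: real) (c :: real) (C1 :: real) (C2 :: real) (C3 :: real).
      \<delta> > 0 \<and> c > 0 \<and> C1 > 0 \<and> C2 > 0 \<and> C3 > 0 \<and>
      (\<forall>K L. K \<ge> 1 \<and> L > 0 \<and> n ^ K dvd L \<longrightarrow>
         is_layout n K L (pos K L) (curve K L) \<and>
         (\<forall>u\<in>sites n K L. \<forall>v\<in>sites n K L. u \<noteq> v \<longrightarrow>
            torus_dist (pos K L u) (pos K L v) \<ge> \<delta>) \<and>
         (\<forall>k r s. k < K \<and> nearest_neighbors n L k r s \<longrightarrow>
            torus_dist (pos K L (k, r)) (pos K L (k, s)) \<le> C1 * real n ^ k) \<and>
         (\<forall>k w. k < K \<and> w \<in> slice_wires n L k \<longrightarrow>
            curve_length (curve K L w) \<le> ennreal (C2 * real n ^ k)) \<and>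
         (\<forall>k w. Suc k < K \<and> w \<in> promotion_wires n L k \<longrightarrow>
            curve_length (curve K L w) \<le> ennreal (C3 * real n ^ Suc k)) \<and>
         (\<forall>x\<in>torus L.
            real (card {w \<in> wires n K L. x \<in> curve K L w ` {0..1}}) \<le> c))"
proof -
  define pos where "pos (K :: nat) L u = torus_proj L (site_point n u)" for K L u
  \<comment> \<open>A wire may come from several arrows; one of them is chosen, and its path is
    drawn.\<close>
  define arr where "arr K L w = (SOME c. c \<in> arrows n K L \<and> arrow_wire n L c = w)" for K L w
  define curve where "curve K L w = torus_proj L \<circ> arrow_path n (arr K L w)" for K L w
  \<comment> \<open>The Lipschitz constant from \<open>corner_path_lipschitz\<close>, twice the
    taxicab distance between the ends in the plane. It controls continuity, length and the distance
    of the end sites.\<close>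
  define N where "N c = 2 * (\<bar>fst (arrow_end n c) - fst (site_point n (fst c, fst (snd c)))\<bar> +
    \<bar>snd (arrow_end n c) - snd (site_point n (fst c, fst (snd c)))\<bar>)" for c
  have "is_layout n K L (pos K L) (curve K L) \<and>
         (\<forall>u\<in>sites n K L. \<forall>v\<in>sites n K L. u \<noteq> v \<longrightarrow>
            torus_dist (pos K L u) (pos K L v) \<ge> 1/2) \<and>
         (\<forall>k r s. k < K \<and> nearest_neighbors n L k r s \<longrightarrow>
            torus_dist (pos K L (k, r)) (pos K L (k, s)) \<le> 2 * real n ^ k) \<and>
         (\<forall>k w. k < K \<and> w \<in> slice_wires n L k \<longrightarrow>
            curve_length (curve K L w) \<le> ennreal (2 * real n ^ k)) \<and>
         (\<forall>k w. Suc k < K \<and> w \<in> promotion_wires n L k \<longrightarrow>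
            curve_length (curve K L w) \<le> ennreal (4 * real n ^ Suc k)) \<and>
         (\<forall>x\<in>torus L.
            real (card {w \<in> wires n K L. x \<in> curve K L w ` {0..1}}) \<le> real (9 * (2 * n + 1) ^ 2))"
    if L: "L > 0" "n ^ K dvd L" for K L
  proof -
    have arr: "arr K L w \<in> arrows n K L" "arrow_wire n L (arr K L w) = w" if "w \<in> wires n K L" for w
    proof -
      have "\<exists>c. c \<in> arrows n K L \<and> arrow_wire n L c = w"
        using wires_subset_arrow_wires that by blast
      from someI_ex[OF this] show "arr K L w \<in> arrows n K L" "arrow_wire n L (arr K L w) = w"
        unfolding arr_def by auto
    qed
    have lip: "torus_dist (curve K L w s) (curve K L w t) \<le> N (arr K L w) * \<bar>s - t\<bar>" for w s t
      unfolding curve_def comp_def arrow_path_def N_def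
      by (rule order_trans[OF torus_dist_proj_le corner_path_lipschitz])
    have length: "curve_length (curve K L w) \<le> ennreal (N (arr K L w))" for w
      using lip by (intro curve_length_le_lipschitz) (auto simp: N_def)
    have ends: "{curve K L w 0, curve K L w 1} = pos K L ` w" if "w \<in> wires n K L" for w
    proof -
      have "pos K L ` arrow_wire n L (arr K L w) = {curve K L w 0, curve K L w 1}"
        using torus_proj_arrow_end[OF L(2) arr(1)[OF that]]
        by (simp add: curve_def arrow_path_def corner_path_0 corner_path_1 arrow_wire_def pos_def)
      then show ?thesis
        using arr(2)[OF that] by simp
    qed
    have slice: "w \<in> wires n K L" "N (arr K L w) = 2 * real n ^ k"
      if "k < K" "w \<in> slice_wires n L k" for k w
    proof -
      show w: "w \<in> wires n K L"
        using that unfolding wires_def by blast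
      obtain l r d where c: "arr K L w = (l, r, d)"
        by (metis prod.exhaust)
      then have "l = k" "d \<noteq> Promote"
        using slice_wire_arrow_cases that(2) arr(2)[OF w] by metis+
      then show "N (arr K L w) = 2 * real n ^ k"
        unfolding N_def c fst_conv snd_conv by (subst arrow_end_slice_near) auto
    qed
    have promotion: "N (arr K L w) \<le> 4 * real n ^ Suc k"
      if "Suc k < K" "w \<in> promotion_wires n L k" for k w
    proof -
      have w: "w \<in> wires n K L"
        using that unfolding wires_def by blast
      obtain l r d where c: "arr K L w = (l, r, d)"
        by (metis prod.exhaust)
      then have "l = k"
        using promotion_wire_arrow_cases that(2) arr(2)[OF w] by metis
      moreover have "n > 0"
        using assms by simp
      \<comment> \<open>The constant 4 is the factor 2 in \<open>N\<close> times two coordinates,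
        each displaced by at most \<open>n ^ Suc k\<close>.\<close>
      ultimately show ?thesis
        unfolding N_def c fst_conv snd_conv using arrow_end_near[of n k r d] by simp
    qed
    have layout: "is_layout n K L (pos K L) (curve K L)"
      unfolding is_layout_def
    proof (intro conjI ballI)
      show "pathin (torus_topology L) (curve K L w)" for w
        by (rule pathin_torus_lipschitz[OF L(1) _ lip]) (simp add: curve_def torus_proj_in_torus)
    qed (use ends in \<open>auto simp: pos_def torus_proj_in_torus\<close>)
    have separated: "torus_dist (pos K L u) (pos K L v) \<ge> 1/2"
      if "u \<in> sites n K L" "v \<in> sites n K L" "u \<noteq> v" for u v
      using site_points_separated[OF assms L(2) that] by (simp add: pos_def)
    have neighbors: "torus_dist (pos K L (k, r)) (pos K L (k, s)) \<le> 2 * real n ^ k"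
      if k: "k < K" and nn: "nearest_neighbors n L k r s" for k r s
    proof -
      let ?w = "{(k, r), (k, s)}"
      have w: "?w \<in> slice_wires n L k"
        using nn unfolding slice_wires_def by blast
      \<comment> \<open>The wire between the neighbors bounds their distance, also across the
        boundary of the fundamental domain. The orientation of its arrow is unknown, which the
        symmetry of the distance absorbs.\<close>
      have "{curve K L ?w 0, curve K L ?w 1} = {pos K L (k, r), pos K L (k, s)}"
        using ends[OF slice(1)[OF k w]] by simp
      then have "torus_dist (pos K L (k, r)) (pos K L (k, s)) =
          torus_dist (curve K L ?w 0) (curve K L ?w 1)"
        by (auto simp: doubleton_eq_iff setdist_sym)
      then show ?thesis
        using lip[of ?w 0 1] slice(2)[OF k w] by simp
    qed
    have count: "card {w \<in> wires n K L. x \<in> curve K L w ` {0..1}} \<le> 9 * (2 * n + 1) ^ 2"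
      if x: "x \<in> torus L" for x
    proof -
      let ?S = "{c \<in> arrows n K L. x \<in> (torus_proj L \<circ> arrow_path n c) ` {0..1}}"
      \<comment> \<open>Each wire through \<open>x\<close> is the image of its chosen arrow, whose
        projected path contains \<open>x\<close>; hence there are at most as many such wires as such
        arrows.\<close>
      have "{w \<in> wires n K L. x \<in> curve K L w ` {0..1}} \<subseteq> arrow_wire n L ` ?S"
        using arr unfolding curve_def by (fastforce intro!: image_eqI)
      moreover have "finite ?S" "card ?S \<le> 9 * (2 * n + 1) ^ 2"
        using arrows_through_point[OF assms L(2) x] by auto
      ultimately show ?thesis
        by (meson card_image_le card_mono finite_imageI order_trans)
    qed
    show ?thesis
    proof (intro conjI allI ballI impI; (elim conjE)?)
      show "curve_length (curve K L w) \<le> ennreal (2 * real n ^ k)"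
        if "k < K" "w \<in> slice_wires n L k" for k w
        using length[of w] slice(2)[OF that] by simp
      show "curve_length (curve K L w) \<le> ennreal (4 * real n ^ Suc k)"
        if "Suc k < K" "w \<in> promotion_wires n L k" for k w
        using length[of w] ennreal_leI[OF promotion[OF that]] by (rule order_trans)
      show "real (card {w \<in> wires n K L. x \<in> curve K L w ` {0..1}}) \<le> real (9 * (2 * n + 1) ^ 2)"
        if "x \<in> torus L" for x
        using count[OF that] by (rule of_nat_mono)
    qed (use layout separated neighbors in auto)
  qed
  note layouts = this
  show ?thesis
    by (rule exI[of _ pos], rule exI[of _ curve], rule exI[of _ "1/2"],
        rule exI[of _ "real (9 * (2 * n + 1) ^ 2)"], rule exI[of _ 2], rule exI[of _ 2],
        rule exI[of _ 4])
      (use layouts in \<open>simp del: of_nat_mult of_nat_power\<close>)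
qed

end
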